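(* Let $\Omega\subset\mathbb{R}^2$ be an open set, $f:\Omega\to\mathbb{R}$ a smooth function, $S=X(\Omega)\subset\mathcal{H}_3$ its graph, where $X(x,y)=(x,y,f(x,y))$, and let $\phi:\Omega\to\mathcal{P}$ be the Gauss map of $S$. 1. If $\rho_\theta:\mathcal{H}_3\to\mathcal{H}_3$ is the rotation about the $z$-axis by an angle $\theta$, then the Gauss map of $\rho_\theta(S)$ is $r_\theta\circ\phi$, where $r_\theta:\mathcal{P}\to\mathcal{P}$ is the rotation about the origin by the angle $\theta$. 2. Let $(a,b)\in\mathbb{R}^2\setminus\{(0,0)\}$. If $\sigma:\mathcal{H}_3\to\mathcal{H}_3$ is the reflection across the line $ax+by=0$ (acting on the $(x,y)$-coordinates) composed with the reflection $z\mapsto -z$ about the plane $z=0$, then the Gauss map of $\sigma(S)$ is $\tau\circ\phi$, where $\tau:\mathcal{P}\to\mathcal{P}$ is the reflection across the line $-bx+ay=0$. 3. If $L:\mathcal{H}_3\to\mathcal{H}_3$ is a left translation, then the Gauss map of $L(S)$ is $\phi$. Here Gauss maps are compared at corresponding points: for $\Phi\in\{\rho_\theta,\sigma,L\}$, if $(\bar x,\bar y)$ denotes the first two coordinates of $\Phi(X(x,y))$ and $\tilde\phi$ denotes the Gauss map of the graph $\Phi(S)$, then for all $(x,y)\in\Omega$ one has $\tilde\phi(\bar x,\bar y)=r_\theta(\phi(x,y))$, $\tilde\phi(\bar x,\bar y)=\tau(\phi(x,y))$, and $\tilde\phi(\bar x,\bar y)=\phi(x,y)$, in cases 1, 2, 3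 respectively.
   Context: The Heisenberg group $\mathcal{H}_3$ is $\mathbb{R}^3$ with the product $(a,b,c)*(x,y,z)=(a+x,\,b+y,\,c+z+\frac{ay-bx}{2})$ and the left-invariant Riemannian metric $ds^2=dx^2+dy^2+\left(\frac12 y\,dx-\frac12 x\,dy+dz\right)^2$. The left translation by $(a,b,c)$ is the map $(x,y,z)\mapsto(a,b,c)*(x,y,z)$. The Gans model $\mathcal{P}$ of the hyperbolic plane is $\mathbb{R}^2$ with the metric $h=\frac{(1+v^2)du^2-2uv\,du\,dv+(1+u^2)dv^2}{1+u^2+v^2}$ in its coordinates $(u,v)$; in the statement, a line $-bx+ay=0$ in $\mathcal{P}$ means the set of points of $\mathbb{R}^2$ whose coordinates $(x,y)$ satisfy this equation, and rotations and reflections of $\mathcal{P}$ are the usual linear ones of $\mathbb{R}^2$. For the graph of a smooth function $f$ over an open set $\Omega\subset\mathbb{R}^2$, the Gauss map (the unit normal with positive vertical component, left-translated to the identity, followed by central projection from the origin of the open upper hemisphere onto the plane $z=1$, identified with $\mathcal{P}$) is the map $\phi:\Omega\to\mathcal{P}$ given by $$\phi(x,y)=\left(-\left(f_x+\tfrac y2\right),\,-\left(f_y-\tfrac x2\right)\right).$$ The same formula, with the corresponding function in place of $f$, defines the Gauss map of each of the graphs $\rho_\theta(S)$, $\sigma(S)$, $L(S)$ over its own domain. *)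

theory Defs
  imports "HOL-Analysis.Analysis"
begin

(* Iterated Frechet differentiability: for an open set S this is membership in C^n(S). *)
primrec higher_differentiable_on ::
  "'a::real_normed_vector set \<Rightarrow> ('a \<Rightarrow> 'b::real_normed_vector) \<Rightarrow> nat \<Rightarrow> bool" where
  "higher_differentiable_on S f 0 \<longleftrightarrow> continuous_on S f"
| "higher_differentiable_on S f (Suc n) \<longleftrightarrow>
     (\<forall>x\<in>S. f differentiable (at x)) \<and>
     (\<forall>v. higher_differentiable_on S (\<lambda>x. frechet_derivative f (at x) v) n)"

definition smooth_on :: "'a::real_normed_vector set \<Rightarrow> ('a \<Rightarrow> 'b::real_normed_vector) \<Rightarrow> bool" where
  "smooth_on S f \<longleftrightarrow> (\<forall>n. higher_differentiable_on S f n)"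

type_synonym heis = "real \<times> real \<times> real"

fun heis_mult :: "heis \<Rightarrow> heis \<Rightarrow> heis" where
  "heis_mult (a, b, c) (x, y, z) = (a + x, b + y, c + z + (a * y - b * x) / 2)"

definition left_translation :: "heis \<Rightarrow> heis \<Rightarrow> heis" where
  "left_translation p = (\<lambda>q. heis_mult p q)"

(* The left-invariant metric at a point, applied to two tangent vectors. *)
fun heis_metric :: "heis \<Rightarrow> heis \<Rightarrow> heis \<Rightarrow> real" where
  "heis_metric (x, y, z) (v1, v2, v3) (w1, w2, w3) =
     v1 * w1 + v2 * w2 + (y * v1 / 2 - x * v2 / 2 + v3) * (y * w1 / 2 - x * w2 / 2 + w3)"

fun graph_param :: "(real \<times> real \<Rightarrow> real) \<Rightarrow> real \<times> real \<Rightarrow> heis" where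
  "graph_param f (x, y) = (x, y, f (x, y))"

(* S is the graph of the smooth function f over the open set \<Omega>; the values of f
   off \<Omega> are irrelevant. *)
definition smooth_graph :: "heis set \<Rightarrow> (real \<times> real) set \<Rightarrow> (real \<times> real \<Rightarrow> real) \<Rightarrow> bool" where
  "smooth_graph S \<Omega> f \<longleftrightarrow> open \<Omega> \<and> smooth_on \<Omega> f \<and> S = graph_param f ` \<Omega>"

fun heis_proj :: "heis \<Rightarrow> real \<times> real" where
  "heis_proj (x, y, z) = (x, y)"

definition partial_x :: "(real \<times> real \<Rightarrow> real) \<Rightarrow> real \<times> real \<Rightarrow> real" where
  "partial_x f p = deriv (\<lambda>t. f (t, snd p)) (fst p)"

definition partial_y :: "(real \<times> real \<Rightarrow> real) \<Rightarrow> real \<times> real \<Rightarrow> real" where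
  "partial_y f p = deriv (\<lambda>t. f (fst p, t)) (snd p)"

definition gauss_map :: "(real \<times> real \<Rightarrow> real) \<Rightarrow> real \<times> real \<Rightarrow> real \<times> real" where
  "gauss_map f p = (- (partial_x f p + snd p / 2), - (partial_y f p - fst p / 2))"

(* The formula above is the geometric Gauss map: N is a unit normal of the graph at P, (n1, n2, n3)
   is its left translate to the identity (the group inverse of P is - P), and
   (n1 / n3, n2 / n3) is the central projection to the plane z = 1. *)
lemma gauss_map_eq_projected_normal:
  fixes f :: "real \<times> real \<Rightarrow> real" and p :: "real \<times> real" and N :: heis
  defines "P \<equiv> graph_param f p"
  assumes diff: "f differentiable (at p)"
    and normal: "\<And>v. heis_metric P N (frechet_derivative (graph_param f) (at p) v) = 0"
    and unit: "heis_metric P N N = 1"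
    and transl: "frechet_derivative (left_translation (- P)) (at P) N = (n1, n2, n3)"
    and up: "n3 > 0"
  shows "gauss_map f p = (n1 / n3, n2 / n3)"
proof -
  obtain x y where p: "p = (x, y)" by (cases p)
  obtain N1 N2 N3 where N: "N = (N1, N2, N3)" by (cases N)
  define D where "D = frechet_derivative f (at p)"
  have D: "(f has_derivative D) (at (x, y))"
    using diff by (simp add: D_def p frechet_derivative_works)
  then have lin: "linear D" by (rule has_derivative_linear)
  have gp: "graph_param f = (\<lambda>q. (fst q, snd q, f q))"
    by (auto simp: fun_eq_iff)
  have "(graph_param f has_derivative (\<lambda>v. (fst v, snd v, D v))) (at p)"
    unfolding gp p by (intro has_derivative_Pair has_derivative_fst has_derivative_snd
        has_derivative_ident D)
  then have dX: "frechet_derivative (graph_param f) (at p) = (\<lambda>v. (fst v, snd v, D v))"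
    by (rule frechet_derivative_at[symmetric])
  have lt: "left_translation (- P) =
      (\<lambda>q. (fst q - x, fst (snd q) - y,
             snd (snd q) - f (x, y) + (y * fst q - x * fst (snd q)) / 2))"
    by (auto simp: fun_eq_iff left_translation_def P_def p)
  have "(left_translation (- P) has_derivative
      (\<lambda>v. (fst v, fst (snd v), snd (snd v) + (y * fst v - x * fst (snd v)) / 2))) (at P)"
    unfolding lt by (auto intro!: derivative_eq_intros simp: fun_eq_iff)
  then have "frechet_derivative (left_translation (- P)) (at P) =
      (\<lambda>v. (fst v, fst (snd v), snd (snd v) + (y * fst v - x * fst (snd v)) / 2))"
    by (rule frechet_derivative_at[symmetric])
  with transl have n: "n1 = N1" "n2 = N2" "n3 = N3 + (y * N1 - x * N2) / 2"
    by (auto simp: N)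
  have "((\<lambda>t. f (t, y)) has_derivative (\<lambda>h. D (h, 0))) (at x)"
    by (rule has_derivative_compose[of "\<lambda>t. (t, y)" "\<lambda>h. (h, 0)" x UNIV f D])
      (auto intro!: derivative_eq_intros D)
  moreover have "(\<lambda>h. D (h, 0)) = (*) (D (1, 0))"
  proof
    show "D (h, 0) = D (1, 0) * h" for h
      using linear_scale[OF lin, of h "(1, 0)"] by simp
  qed
  ultimately have fx: "partial_x f p = D (1, 0)"
    unfolding partial_x_def p fst_conv snd_conv
    by (intro DERIV_imp_deriv) (simp only: has_field_derivative_def)
  have "((\<lambda>t. f (x, t)) has_derivative (\<lambda>h. D (0, h))) (at y)"
    by (rule has_derivative_compose[of "\<lambda>t. (x, t)" "\<lambda>h. (0, h)" y UNIV f D])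
      (auto intro!: derivative_eq_intros D)
  moreover have "(\<lambda>h. D (0, h)) = (*) (D (0, 1))"
  proof
    show "D (0, h) = D (0, 1) * h" for h
      using linear_scale[OF lin, of h "(0, 1)"] by simp
  qed
  ultimately have fy: "partial_y f p = D (0, 1)"
    unfolding partial_y_def p fst_conv snd_conv
    by (intro DERIV_imp_deriv) (simp only: has_field_derivative_def)
  have "n1 + n3 * (y / 2 + D (1, 0)) = 0"
    using normal[of "(1, 0)"] by (simp add: dX[unfolded p] P_def p N n field_simps)
  moreover have "n2 + n3 * (D (0, 1) - x / 2) = 0"
    using normal[of "(0, 1)"] by (simp add: dX[unfolded p] P_def p N n field_simps)
  ultimately show ?thesis
    using up fx fy by (simp add: gauss_map_def p field_simps)
qed

(* Counterclockwise rotation of the plane about the origin. *)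
fun plane_rotation :: "real \<Rightarrow> real \<times> real \<Rightarrow> real \<times> real" where
  "plane_rotation \<theta> (x, y) = (cos \<theta> * x - sin \<theta> * y, sin \<theta> * x + cos \<theta> * y)"

(* Reflection across the line {(x, y). a * x + b * y = 0}, for (a, b) not the origin. *)
definition plane_reflection :: "real \<Rightarrow> real \<Rightarrow> real \<times> real \<Rightarrow> real \<times> real" where
  "plane_reflection a b p = p - (2 * ((a, b) \<bullet> p) / ((a, b) \<bullet> (a, b))) *\<^sub>R (a, b)"

fun heis_rotation :: "real \<Rightarrow> heis \<Rightarrow> heis" where
  "heis_rotation \<theta> (x, y, z) =
     (cos \<theta> * x - sin \<theta> * y, sin \<theta> * x + cos \<theta> * y, z)"

fun heis_reflection :: "real \<Rightarrow> real \<Rightarrow> heis \<Rightarrow> heis" where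
  "heis_reflection a b (x, y, z) =
     (fst (plane_reflection a b (x, y)), snd (plane_reflection a b (x, y)), - z)"

end

theory Submission
  imports Defs
begin

text \<open>
  Write \<open>J\<close> for the quarter turn of the plane.  Then \<open>\<phi> = J p / 2 - \<nabla>f\<close> is the Gauss map of the
  graph of \<open>f\<close>, and this form makes its behaviour under isometries a one-line computation.  Each
  of the three kinds of isometry covers a rigid motion \<open>p \<mapsto> A p + k\<close> of the plane and acts
  on heights by \<open>z \<mapsto> \<epsilon> z + m \<bullet> p + d\<close>.  The image of a graph under such a map is the graph of
  the function \<open>g\<close> with \<open>g (A p + k) = \<epsilon> f p + m \<bullet> p + d\<close>.  Differentiating, with \<open>A\<close> orthogonal,
  gives \<open>\<nabla>g = A (\<epsilon> \<nabla>f + m)\<close> at corresponding points, and therefore, if \<open>J A = \<epsilon> A J\<close>,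
  \<open>\<phi>\<^sub>g = \<epsilon> A \<phi>\<^sub>f + (J k / 2 - A m)\<close> (lemma \<open>gauss_map_affine_lift\<close>).

  It remains to read off the data.  A rotation commutes with \<open>J\<close> and has \<open>\<epsilon> = 1\<close> and \<open>k = m = 0\<close>.  A
  plane reflection \<open>A\<close> anticommutes with \<open>J\<close>, which fits the sign \<open>\<epsilon> = -1\<close> of \<open>z \<mapsto> -z\<close>; here
  \<open>- A\<close> is the reflection across the perpendicular line, which is why \<open>\<tau>\<close> uses \<open>-b x + a y = 0\<close>.  For
  a left translation \<open>A\<close> is the identity and \<open>m = J k / 2\<close>: the twist of the group law cancels
  exactly the change of \<open>J p / 2\<close>.

  Smoothness of \<open>g\<close> holds because \<open>g\<close> is, up to an affine summand, a multiple of the composite of \<open>f\<close>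
  with an affine map, and this class of functions is closed under taking directional derivatives.
\<close>

section \<open>Affine changes of variable\<close>

lemma has_derivative_affine_pullback:
  fixes f :: "'b::real_normed_vector \<Rightarrow> 'c::real_normed_vector"
    and B :: "'a::real_normed_vector \<Rightarrow> 'b"
  assumes "open U" "q \<in> U" "bounded_linear B" "bounded_linear l"
    and D: "(f has_derivative D) (at (B q + k))"
    and g: "\<And>x. x \<in> U \<Longrightarrow> g x = c *\<^sub>R f (B x + k) + (l x + d)"
  shows "(g has_derivative (\<lambda>v. c *\<^sub>R D (B v) + l v)) (at q)"
proof -
  have B: "((\<lambda>x. B x + k) has_derivative B) (at q)"
    using has_derivative_add[OF bounded_linear_imp_has_derivative[OF \<open>bounded_linear B\<close>]
        has_derivative_const] by simp
  have l: "((\<lambda>x. l x + d) has_derivative l) (at q)"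
    using has_derivative_add[OF bounded_linear_imp_has_derivative[OF \<open>bounded_linear l\<close>]
        has_derivative_const] by simp
  have "((\<lambda>x. c *\<^sub>R f (B x + k) + (l x + d)) has_derivative (\<lambda>v. c *\<^sub>R D (B v) + l v)) (at q)"
    by (intro has_derivative_add has_derivative_scaleR_right l has_derivative_compose[OF B D])
  then show ?thesis
    by (rule has_derivative_transform_within_open[OF _ \<open>open U\<close> \<open>q \<in> U\<close>]) (simp add: g)
qed

text \<open>
  The affine summand \<open>l x + d\<close> and the freedom of \<open>g\<close> outside \<open>U\<close> make the induction work: the
  derivative of \<open>g\<close> in a direction \<open>v\<close> is again of this form, with the derivative of \<open>f\<close> in the direction
  \<open>B v\<close> in place of \<open>f\<close>, zero in place of \<open>l\<close> and \<open>l v\<close> in place of \<open>d\<close>, but only on \<open>U\<close>.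
\<close>

lemma higher_differentiable_on_affine_pullback:
  fixes f :: "'b::real_normed_vector \<Rightarrow> 'c::real_normed_vector"
    and B :: "'a::real_normed_vector \<Rightarrow> 'b"
  assumes "higher_differentiable_on V f n"
    and "open U" "bounded_linear B" "bounded_linear l"
    and "\<And>x. x \<in> U \<Longrightarrow> B x + k \<in> V"
    and "\<And>x. x \<in> U \<Longrightarrow> g x = c *\<^sub>R f (B x + k) + (l x + d)"
  shows "higher_differentiable_on U g n"
  using assms
proof (induction n arbitrary: f g l d)
  case 0
  have "continuous_on V f" using "0.prems"(1) by simp
  moreover have "continuous_on U (\<lambda>x. B x + k)"
    by (intro continuous_on_add continuous_on_const linear_continuous_on "0.prems"(3))
  ultimately have "continuous_on U (\<lambda>x. f (B x + k))"
    by (rule continuous_on_compose2) (use "0.prems"(5) in blast)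
  moreover have "continuous_on U l"
    by (rule linear_continuous_on[OF "0.prems"(4)])
  ultimately have "continuous_on U (\<lambda>x. c *\<^sub>R f (B x + k) + (l x + d))"
    by (intro continuous_on_add continuous_on_scaleR continuous_on_const)
  then have "continuous_on U g"
    by (rule continuous_on_eq) (simp add: "0.prems"(6))
  then show ?case by simp
next
  case (Suc n)
  have f: "(f has_derivative frechet_derivative f (at (B x + k))) (at (B x + k))" if "x \<in> U" for x
    using Suc.prems(1) Suc.prems(5)[OF that] by (simp flip: frechet_derivative_works)
  have g: "(g has_derivative (\<lambda>v. c *\<^sub>R frechet_derivative f (at (B x + k)) (B v) + l v)) (at x)"
    if "x \<in> U" for x
    using has_derivative_affine_pullback[OF Suc.prems(2) that Suc.prems(3,4) f[OF that] Suc.prems(6)]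
    by simp
  have "higher_differentiable_on U (\<lambda>x. frechet_derivative g (at x) v) n" for v
  proof (rule Suc.IH)
    show "higher_differentiable_on V (\<lambda>y. frechet_derivative f (at y) (B v)) n"
      using Suc.prems(1) by simp
    show "bounded_linear (\<lambda>x::'a. 0 :: 'c)" by (rule bounded_linear_zero)
    show "frechet_derivative g (at x) v
        = c *\<^sub>R frechet_derivative f (at (B x + k)) (B v) + (0 + l v)" if "x \<in> U" for x
      using frechet_derivative_at[OF g[OF that], symmetric] by simp
  qed (rule Suc.prems; assumption)+
  moreover have "\<forall>x\<in>U. g differentiable (at x)"
    using g by (auto simp: differentiable_def)
  ultimately show ?case by simp
qed

section \<open>The Gauss map as a gradient\<close>

definition grad :: "(real \<times> real \<Rightarrow> real) \<Rightarrow> real \<times> real \<Rightarrow> real \<times> real" where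
  "grad f p = (partial_x f p, partial_y f p)"

fun quarter_turn :: "real \<times> real \<Rightarrow> real \<times> real" where
  "quarter_turn (x, y) = (- y, x)"

lemma gauss_map_eq_grad: "gauss_map f p = (1 / 2) *\<^sub>R quarter_turn p - grad f p"
  by (cases p) (simp add: gauss_map_def grad_def)

lemma quarter_turn_add: "quarter_turn (p + q) = quarter_turn p + quarter_turn q"
  by (cases p; cases q) simp

lemma has_derivative_imp_inner_grad:
  assumes D: "(f has_derivative D) (at p)"
  shows "D v = grad f p \<bullet> v"
proof -
  obtain x y where p: "p = (x, y)" by (cases p)
  have lin: "linear D" using D by (rule has_derivative_linear)
  have "((\<lambda>t. f (t, y)) has_derivative (\<lambda>h. D (h, 0))) (at x)"
    by (rule has_derivative_compose[of "\<lambda>t. (t, y)" "\<lambda>h. (h, 0)" x UNIV f D])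
      (auto intro!: derivative_eq_intros D[unfolded p])
  moreover have "(\<lambda>h. D (h, 0)) = (*) (D (1, 0))"
  proof
    show "D (h, 0) = D (1, 0) * h" for h
      using linear_scale[OF lin, of h "(1, 0)"] by simp
  qed
  ultimately have x: "partial_x f p = D (1, 0)"
    unfolding partial_x_def p fst_conv snd_conv
    by (intro DERIV_imp_deriv) (simp only: has_field_derivative_def)
  have "((\<lambda>t. f (x, t)) has_derivative (\<lambda>h. D (0, h))) (at y)"
    by (rule has_derivative_compose[of "\<lambda>t. (x, t)" "\<lambda>h. (0, h)" y UNIV f D])
      (auto intro!: derivative_eq_intros D[unfolded p])
  moreover have "(\<lambda>h. D (0, h)) = (*) (D (0, 1))"
  proof
    show "D (0, h) = D (0, 1) * h" for h
      using linear_scale[OF lin, of h "(0, 1)"] by simp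
  qed
  ultimately have y: "partial_y f p = D (0, 1)"
    unfolding partial_y_def p fst_conv snd_conv
    by (intro DERIV_imp_deriv) (simp only: has_field_derivative_def)
  have "D v = D (fst v *\<^sub>R (1, 0) + snd v *\<^sub>R (0, 1))" by simp
  also have "\<dots> = fst v * D (1, 0) + snd v * D (0, 1)"
    by (simp only: linear_add[OF lin] linear_scale[OF lin] real_scaleR_def)
  finally show ?thesis by (cases v) (simp add: grad_def x y)
qed

lemma grad_unique:
  assumes "(f has_derivative (\<lambda>v. w \<bullet> v)) (at p)"
  shows "grad f p = w"
proof -
  have "\<forall>v. grad f p \<bullet> v = w \<bullet> v"
    by (simp flip: has_derivative_imp_inner_grad[OF assms])
  then show ?thesis
    by (simp only: vector_eq_rdot)
qed

section \<open>Maps of the Heisenberg group that cover a plane motion\<close>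

text \<open>
  The common form of rotations, reflections and left translations.  It is an isometry of the
  Heisenberg metric when \<open>A\<close> is orthogonal, \<open>\<epsilon> = det A\<close> and \<open>A m = J k / 2\<close>: these make the form
  \<open>y dx / 2 - x dy / 2 + dz\<close> change only by the sign \<open>\<epsilon>\<close>.
\<close>

definition affine_lift ::
  "(real \<times> real \<Rightarrow> real \<times> real) \<Rightarrow> real \<times> real \<Rightarrow> real \<Rightarrow> real \<times> real \<Rightarrow> real \<Rightarrow> heis \<Rightarrow> heis" where
  "affine_lift A k \<epsilon> m d P =
     (let p = heis_proj P; q = A p + k in (fst q, snd q, \<epsilon> * snd (snd P) + m \<bullet> p + d))"

lemma heis_proj_graph_param [simp]: "heis_proj (graph_param f p) = p"
  by (cases p) simp

lemma graph_param_eq: "graph_param f p = (fst p, snd p, f p)"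
  by (cases p) simp

lemma affine_lift_graph_param:
  "affine_lift A k \<epsilon> m d (graph_param f p) = graph_param g q \<longleftrightarrow>
     q = A p + k \<and> g q = \<epsilon> * f p + m \<bullet> p + d"
  by (auto simp: affine_lift_def Let_def graph_param_eq prod_eq_iff)

lemma heis_proj_affine_lift [simp]:
  "heis_proj (affine_lift A k \<epsilon> m d (graph_param f p)) = A p + k"
  by (simp add: affine_lift_def Let_def prod_eq_iff)

lemma inner_inv_orthogonal:
  assumes "orthogonal_transformation (A :: 'a::euclidean_space \<Rightarrow> 'a)"
  shows "w \<bullet> inv A v = A w \<bullet> v"
proof -
  have "A w \<bullet> A (inv A v) = w \<bullet> inv A v"
    using assms by (simp add: orthogonal_transformation_def)
  then show ?thesis
    using orthogonal_transformation_surj[OF assms] by (simp add: surj_f_inv_f)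
qed

text \<open>
  A set determines the domain and the values of any function of which it is the graph.  The formula
  for \<open>g\<close> uses \<open>m \<bullet> inv A v = A m \<bullet> v\<close>, so that it has the shape required for an affine
  pullback: \<open>f\<close> after the inverse motion \<open>q \<mapsto> inv A q - inv A k\<close>, plus an affine function of \<open>q\<close>.
\<close>

lemma affine_lift_of_graphD:
  assumes A: "orthogonal_transformation A"
    and eq: "affine_lift A k \<epsilon> m d ` graph_param f ` \<Omega> = graph_param g ` \<Omega>'"
  shows "p \<in> \<Omega> \<Longrightarrow> A p + k \<in> \<Omega>'"
    and "q \<in> \<Omega>' \<Longrightarrow> inv A q + - inv A k \<in> \<Omega>"
    and "q \<in> \<Omega>' \<Longrightarrow> g q = \<epsilon> *\<^sub>R f (inv A q + - inv A k)
           + (A m \<bullet> q + (d - A m \<bullet> k))"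
proof -
  show "A p + k \<in> \<Omega>'" if "p \<in> \<Omega>"
  proof -
    have "affine_lift A k \<epsilon> m d (graph_param f p) \<in> graph_param g ` \<Omega>'"
      using that unfolding eq[symmetric] by (intro imageI)
    then obtain q where "q \<in> \<Omega>'" "affine_lift A k \<epsilon> m d (graph_param f p) = graph_param g q"
      by blast
    then show ?thesis by (simp add: affine_lift_graph_param)
  qed
  have inv: "inv A (A p + k) + - inv A k = p" for p
    using linear_add[OF orthogonal_transformation_linear[OF orthogonal_transformation_inv[OF A]]]
      orthogonal_transformation_inj[OF A] by simp
  have q: "\<exists>p\<in>\<Omega>. q = A p + k \<and> g q = \<epsilon> * f p + m \<bullet> p + d" if "q \<in> \<Omega>'"
  proof -
    have "graph_param g q \<in> affine_lift A k \<epsilon> m d ` graph_param f ` \<Omega>"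
      using that unfolding eq by (rule imageI)
    then obtain p where "p \<in> \<Omega>" "affine_lift A k \<epsilon> m d (graph_param f p) = graph_param g q"
      by (metis imageE)
    then show ?thesis unfolding affine_lift_graph_param by (rule bexI[rotated])
  qed
  show "inv A q + - inv A k \<in> \<Omega>" if "q \<in> \<Omega>'"
    using q[OF that] inv by auto
  show "g q = \<epsilon> *\<^sub>R f (inv A q + - inv A k) + (A m \<bullet> q + (d - A m \<bullet> k))"
    if q': "q \<in> \<Omega>'"
  proof -
    obtain p where p: "q = A p + k" "g q = \<epsilon> * f p + m \<bullet> p + d" using q[OF q'] by blast
    have "A m \<bullet> A p = m \<bullet> p" using A unfolding orthogonal_transformation_def by blast
    then show ?thesis using p inv[of p] by (simp add: inner_add_right)
  qed
qed

lemma smooth_graph_affine_lift: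
  assumes S: "smooth_graph S \<Omega> f" and A: "orthogonal_transformation A"
  shows "\<exists>\<Omega>' g. smooth_graph (affine_lift A k \<epsilon> m d ` S) \<Omega>' g"
proof -
  define \<Omega>' where "\<Omega>' = (\<lambda>p. A p + k) ` \<Omega>"
  define g where "g q = \<epsilon> * f (inv A (q - k)) + m \<bullet> inv A (q - k) + d" for q
  have lin: "linear (inv A)"
    using A by (intro orthogonal_transformation_linear orthogonal_transformation_inv)
  have "affine_lift A k \<epsilon> m d (graph_param f p) = graph_param g (A p + k)" for p
    using orthogonal_transformation_inj[OF A] by (simp add: affine_lift_graph_param g_def)
  then have eq: "affine_lift A k \<epsilon> m d ` graph_param f ` \<Omega> = graph_param g ` \<Omega>'"
    by (simp add: \<Omega>'_def image_image)
  have "open (A ` \<Omega>)"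
    using S A by (intro open_surjective_linear_image)
      (auto simp: smooth_graph_def orthogonal_transformation_linear orthogonal_transformation_surj)
  then have op: "open \<Omega>'"
    using open_translation[of "A ` \<Omega>" k] by (simp add: \<Omega>'_def image_image add.commute)
  have "smooth_on \<Omega>' g"
    unfolding smooth_on_def
  proof
    fix n
    have "higher_differentiable_on \<Omega> f n"
      using S by (simp add: smooth_graph_def smooth_on_def)
    then show "higher_differentiable_on \<Omega>' g n"
      by (rule higher_differentiable_on_affine_pullback[OF _ op
            lin[unfolded linear_conv_bounded_linear] bounded_linear_inner_right
            affine_lift_of_graphD(2,3)[OF A eq]])
  qed
  with op eq S show ?thesis
    unfolding smooth_graph_def by blast
qed

text \<open>
  The gradient of the image graph is \<open>A (\<epsilon> \<nabla>f + m)\<close> because \<open>A\<close>, being orthogonal, is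
  the transpose of its inverse.  The commutation hypothesis moves the term \<open>J A p / 2\<close> behind \<open>A\<close>.
\<close>

lemma gauss_map_affine_lift:
  assumes S: "smooth_graph S \<Omega> f" and A: "orthogonal_transformation A"
    and J: "\<And>p. quarter_turn (A p) = \<epsilon> *\<^sub>R A (quarter_turn p)"
    and g: "smooth_graph (affine_lift A k \<epsilon> m d ` S) \<Omega>' g"
    and p: "p \<in> \<Omega>"
  shows "gauss_map g (A p + k)
     = \<epsilon> *\<^sub>R A (gauss_map f p) + ((1 / 2) *\<^sub>R quarter_turn k - A m)"
proof -
  have eq: "affine_lift A k \<epsilon> m d ` graph_param f ` \<Omega> = graph_param g ` \<Omega>'" and op: "open \<Omega>'"
    using S g by (auto simp: smooth_graph_def)
  have lin: "linear A" and lin': "linear (inv A)"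
    using A by (auto intro: orthogonal_transformation_linear orthogonal_transformation_inv)
  have inv: "inv A (A p + k) + - inv A k = p"
    using linear_add[OF lin'] orthogonal_transformation_inj[OF A] by simp
  have "higher_differentiable_on \<Omega> f (Suc 0)"
    using S by (simp only: smooth_graph_def smooth_on_def)
  then obtain D where D: "(f has_derivative D) (at p)"
    using p by (auto simp: differentiable_def)
  have "D = (\<lambda>v. grad f p \<bullet> v)"
    using has_derivative_imp_inner_grad[OF D] by (rule ext)
  with D have "(f has_derivative (\<lambda>v. grad f p \<bullet> v)) (at (inv A (A p + k) + - inv A k))"
    unfolding inv by simp
  then have "(g has_derivative (\<lambda>v. \<epsilon> *\<^sub>R (grad f p \<bullet> inv A v) + A m \<bullet> v)) (at (A p + k))"
    by (rule has_derivative_affine_pullback[OF op affine_lift_of_graphD(1)[OF A eq p]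
          lin'[unfolded linear_conv_bounded_linear] bounded_linear_inner_right _
          affine_lift_of_graphD(3)[OF A eq]])
  then have "(g has_derivative (\<lambda>v. (\<epsilon> *\<^sub>R A (grad f p) + A m) \<bullet> v)) (at (A p + k))"
    by (simp add: inner_inv_orthogonal[OF A] inner_add_left)
  then have "grad g (A p + k) = \<epsilon> *\<^sub>R A (grad f p) + A m"
    by (rule grad_unique)
  then show ?thesis
    by (simp add: gauss_map_eq_grad quarter_turn_add J linear_diff[OF lin] linear_scale[OF lin]
        algebra_simps)
qed

section \<open>The three families of isometries\<close>

lemma plane_rotation_orthogonal: "orthogonal_transformation (plane_rotation \<theta>)"
proof -
  have "linear (plane_rotation \<theta>)"
    by (rule linearI) (auto simp: algebra_simps)
  moreover have "(c * x - s * y) * (c * x' - s * y') + (s * x + c * y) * (s * x' + c * y')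
      = (c\<^sup>2 + s\<^sup>2) * (x * x' + y * y')" for c s x y x' y' :: real
    by (simp add: algebra_simps power2_eq_square)
  ultimately show ?thesis
    by (auto simp: orthogonal_transformation_def)
qed

lemma heis_rotation_eq_affine_lift:
  "heis_rotation \<theta> = affine_lift (plane_rotation \<theta>) 0 1 0 0"
  by (auto simp: fun_eq_iff affine_lift_def)

lemma inner_reflections:
  fixes n :: "'a::real_inner"
  assumes "n \<noteq> 0"
  shows "(v - (2 * (n \<bullet> v) / (n \<bullet> n)) *\<^sub>R n) \<bullet> (w - (2 * (n \<bullet> w) / (n \<bullet> n)) *\<^sub>R n) = v \<bullet> w"
  using assms by (simp add: inner_diff_left inner_diff_right inner_commute[of v n])

lemma plane_reflection_orthogonal:
  assumes "(a, b) \<noteq> (0, 0)"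
  shows "orthogonal_transformation (plane_reflection a b)"
proof -
  define n where "n = (a, b)"
  have "n \<noteq> 0" using assms by (auto simp: n_def zero_prod_def)
  have eq: "plane_reflection a b = (\<lambda>v. v - (2 * (n \<bullet> v) / (n \<bullet> n)) *\<^sub>R n)"
    by (simp add: plane_reflection_def n_def fun_eq_iff)
  have "linear (plane_reflection a b)"
    unfolding eq by (rule linearI) (simp_all add: inner_add_right scaleR_add_left scaleR_diff_right
        distrib_left add_divide_distrib)
  then show ?thesis
    using inner_reflections[OF \<open>n \<noteq> 0\<close>] by (simp add: orthogonal_transformation_def eq)
qed

text \<open>
  A reflection reverses orientation, so it conjugates the quarter turn to the opposite quarter turn.
\<close>

lemma quarter_turn_plane_reflection:
  assumes "(a, b) \<noteq> (0, 0)"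
  shows "quarter_turn (plane_reflection a b p) = - plane_reflection a b (quarter_turn p)"
proof -
  have "a * a + b * b \<noteq> 0" using assms by (simp add: sum_squares_eq_zero_iff)
  then show ?thesis
    by (cases p) (auto simp: plane_reflection_def field_simps)
qed

text \<open>
  The vectors \<open>(a, b)\<close> and \<open>(- b, a)\<close> are orthogonal, so the two reflections compose to the
  half-turn.
\<close>

lemma plane_reflection_perp:
  assumes "(a, b) \<noteq> (0, 0)"
  shows "plane_reflection (- b) a p = - plane_reflection a b p"
proof -
  have "a * a + b * b \<noteq> 0" "b * b + a * a \<noteq> 0" using assms by (auto simp: sum_squares_eq_zero_iff)
  then show ?thesis
    by (cases p) (auto simp: plane_reflection_def field_simps)
qed

lemma heis_reflection_eq_affine_lift:
  "heis_reflection a b = affine_lift (plane_reflection a b) 0 (- 1) 0 0"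
  by (auto simp: fun_eq_iff affine_lift_def Let_def)

text \<open>The central term \<open>(a y - b x) / 2\<close> of the group law is \<open>J (a, b) \<bullet> (x, y) / 2\<close>.\<close>

lemma left_translation_eq_affine_lift:
  "left_translation (a, b, c) = affine_lift id (a, b) 1 ((1 / 2) *\<^sub>R quarter_turn (a, b)) c"
  by (auto simp: fun_eq_iff affine_lift_def left_translation_def field_simps)

theorem theorem3:
  fixes \<Omega> :: "(real \<times> real) set" and f :: "real \<times> real \<Rightarrow> real" and S :: "heis set"
  assumes "smooth_graph S \<Omega> f"
  shows
    "(\<forall>\<theta>.
        (\<exists>\<Omega>' g. smooth_graph (heis_rotation \<theta> ` S) \<Omega>' g) \<and>
        (\<forall>\<Omega>' g. smooth_graph (heis_rotation \<theta> ` S) \<Omega>' g \<longrightarrow>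
          (\<forall>p\<in>\<Omega>. gauss_map g (heis_proj (heis_rotation \<theta> (graph_param f p))) =
                 plane_rotation \<theta> (gauss_map f p)))) \<and>
     (\<forall>a b. (a, b) \<noteq> (0, 0) \<longrightarrow>
        (\<exists>\<Omega>' g. smooth_graph (heis_reflection a b ` S) \<Omega>' g) \<and>
        (\<forall>\<Omega>' g. smooth_graph (heis_reflection a b ` S) \<Omega>' g \<longrightarrow>
          (\<forall>p\<in>\<Omega>. gauss_map g (heis_proj (heis_reflection a b (graph_param f p))) =
                 plane_reflection (- b) a (gauss_map f p)))) \<and>
     (\<forall>q.
        (\<exists>\<Omega>' g. smooth_graph (left_translation q ` S) \<Omega>' g) \<and>
        (\<forall>\<Omega>' g. smooth_graph (left_translation q ` S) \<Omega>' g \<longrightarrow>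
          (\<forall>p\<in>\<Omega>. gauss_map g (heis_proj (left_translation q (graph_param f p))) =
                 gauss_map f p)))"
proof (intro conjI allI impI ballI)
  note S = assms
  fix \<theta>
  note R = plane_rotation_orthogonal[of \<theta>]
  show "\<exists>\<Omega>' g. smooth_graph (heis_rotation \<theta> ` S) \<Omega>' g"
    unfolding heis_rotation_eq_affine_lift by (rule smooth_graph_affine_lift[OF S R])
  fix \<Omega>' g p
  assume g: "smooth_graph (heis_rotation \<theta> ` S) \<Omega>' g" and p: "p \<in> \<Omega>"
  have "quarter_turn (plane_rotation \<theta> q) = 1 *\<^sub>R plane_rotation \<theta> (quarter_turn q)" for q
    by (cases q) simp
  from gauss_map_affine_lift[OF S R this g[unfolded heis_rotation_eq_affine_lift] p]
  show "gauss_map g (heis_proj (heis_rotation \<theta> (graph_param f p))) = plane_rotation \<theta> (gauss_map f p)"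
    by (simp add: heis_rotation_eq_affine_lift zero_prod_def)
next
  note S = assms
  fix a b :: real
  assume ab: "(a, b) \<noteq> (0, 0)"
  note R = plane_reflection_orthogonal[OF ab]
  show "\<exists>\<Omega>' g. smooth_graph (heis_reflection a b ` S) \<Omega>' g"
    unfolding heis_reflection_eq_affine_lift by (rule smooth_graph_affine_lift[OF S R])
  fix \<Omega>' g p
  assume g: "smooth_graph (heis_reflection a b ` S) \<Omega>' g" and p: "p \<in> \<Omega>"
  have "quarter_turn (plane_reflection a b q) = (- 1) *\<^sub>R plane_reflection a b (quarter_turn q)" for q
    by (simp add: quarter_turn_plane_reflection[OF ab])
  from gauss_map_affine_lift[OF S R this g[unfolded heis_reflection_eq_affine_lift] p]
  show "gauss_map g (heis_proj (heis_reflection a b (graph_param f p)))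
      = plane_reflection (- b) a (gauss_map f p)"
    by (simp add: heis_reflection_eq_affine_lift plane_reflection_perp[OF ab]
        linear_0[OF orthogonal_transformation_linear[OF R]])
      (simp add: zero_prod_def)
next
  note S = assms
  fix t :: heis
  obtain a b c where t: "t = (a, b, c)" by (cases t)
  note T = left_translation_eq_affine_lift[of a b c, folded t]
  note I = orthogonal_transformation_id[folded id_def]
  show "\<exists>\<Omega>' g. smooth_graph (left_translation t ` S) \<Omega>' g"
    unfolding T by (rule smooth_graph_affine_lift[OF S I])
  fix \<Omega>' g p
  assume g: "smooth_graph (left_translation t ` S) \<Omega>' g" and p: "p \<in> \<Omega>"
  have "quarter_turn (id q) = 1 *\<^sub>R id (quarter_turn q)" for q
    by simp
  from gauss_map_affine_lift[OF S I this g[unfolded T] p]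
  show "gauss_map g (heis_proj (left_translation t (graph_param f p))) = gauss_map f p"
    by (simp add: T)
qed

end
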